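(* Let $G$ be a discrete countable group and let $1<p<q<\infty$ with $p\neq 2$. If $G$ has property $F\ell_q$, then $G$ has property $F\ell_p$.
   Context: For $1\le s<\infty$, $\ell_s=\ell_s(\mathbb{N})$ is the Banach space of $s$-summable real sequences. $O(\ell_s)$ is the group of linear bijective isometries of $\ell_s$. An isometric representation of $G$ on $\ell_s$ is a homomorphism $\pi:G\to O(\ell_s)$. A $\pi$-cocycle is a map $b:G\to \ell_s$ with $b(gh)=\pi(g)(b(h))+b(g)$ for all $g,h\in G$. An affine isometric action of $G$ on $\ell_s$ is an action of the form $g(v)=\pi(g)(v)+b(g)$, where $\pi$ is an isometric representation and $b$ is a $\pi$-cocycle. A discrete group $G$ has property $F\ell_s$ if every affine isometric action of $G$ on $\ell_s$ has a $G$-fixed point. Equivalently, for every isometric representation $\pi:G\to O(\ell_s)$, every $\pi$-cocycle is a coboundary, i.e. of the form $b(g)=\pi(g)(v)-v$ for some $v\in\ell_s$. *)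

theory Defs
  imports Complex_Main "HOL-Algebra.Group_Action" "HOL-Library.Countable_Set"
begin

text \<open>
  Since the exponent varies, \<open>\<ell>\<^sub>s\<close> is a carrier set of sequences, with pointwise vector space
  operations. The definitions below are meant for \<open>1 \<le> s\<close>.
\<close>

definition ell :: "real \<Rightarrow> (nat \<Rightarrow> real) set" where
  "ell s = {x. summable (\<lambda>n. \<bar>x n\<bar> powr s)}"

definition ell_norm :: "real \<Rightarrow> (nat \<Rightarrow> real) \<Rightarrow> real" where
  "ell_norm s x = (\<Sum>n. \<bar>x n\<bar> powr s) powr (1 / s)"

definition ell_linear :: "real \<Rightarrow> ((nat \<Rightarrow> real) \<Rightarrow> (nat \<Rightarrow> real)) \<Rightarrow> bool" where
  "ell_linear s T \<longleftrightarrow>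
     (\<forall>x\<in>ell s. \<forall>y\<in>ell s. T (\<lambda>n. x n + y n) = (\<lambda>n. T x n + T y n)) \<and>
     (\<forall>c. \<forall>x\<in>ell s. T (\<lambda>n. c * x n) = (\<lambda>n. c * T x n))"

definition ell_isometry :: "real \<Rightarrow> ((nat \<Rightarrow> real) \<Rightarrow> (nat \<Rightarrow> real)) \<Rightarrow> bool" where
  "ell_isometry s T \<longleftrightarrow>
     (\<forall>x\<in>ell s. \<forall>y\<in>ell s. ell_norm s (\<lambda>n. T x n - T y n) = ell_norm s (\<lambda>n. x n - y n))"

text \<open>
  \<open>O(\<ell>\<^sub>s)\<close>, as a subgroup of the group of all bijections of the set \<open>\<ell>\<^sub>s\<close>. Elements of
  \<^const>\<open>Bij\<close> are \<^const>\<open>undefined\<close> outside \<open>\<ell>\<^sub>s\<close>, so that each isometry is represented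
  by exactly one function.
\<close>

definition ell_O :: "real \<Rightarrow> ((nat \<Rightarrow> real) \<Rightarrow> (nat \<Rightarrow> real)) monoid" where
  "ell_O s = (BijGroup (ell s))\<lparr>carrier := {T \<in> Bij (ell s). ell_linear s T \<and> ell_isometry s T}\<rparr>"

definition isometric_rep ::
    "('a, 'b) monoid_scheme \<Rightarrow> real \<Rightarrow> ('a \<Rightarrow> (nat \<Rightarrow> real) \<Rightarrow> (nat \<Rightarrow> real)) \<Rightarrow> bool" where
  "isometric_rep G s \<pi> \<longleftrightarrow> \<pi> \<in> hom G (ell_O s)"

definition cocycle ::
    "('a, 'b) monoid_scheme \<Rightarrow> real \<Rightarrow> ('a \<Rightarrow> (nat \<Rightarrow> real) \<Rightarrow> (nat \<Rightarrow> real)) \<Rightarrow>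
     ('a \<Rightarrow> nat \<Rightarrow> real) \<Rightarrow> bool" where
  "cocycle G s \<pi> b \<longleftrightarrow> b \<in> carrier G \<rightarrow> ell s \<and>
     (\<forall>g\<in>carrier G. \<forall>h\<in>carrier G. b (g \<otimes>\<^bsub>G\<^esub> h) = (\<lambda>n. \<pi> g (b h) n + b g n))"

definition affine_isometric_action ::
    "('a, 'b) monoid_scheme \<Rightarrow> real \<Rightarrow> ('a \<Rightarrow> (nat \<Rightarrow> real) \<Rightarrow> (nat \<Rightarrow> real)) \<Rightarrow> bool" where
  "affine_isometric_action G s \<alpha> \<longleftrightarrow> group_action G (ell s) \<alpha> \<and>
     (\<exists>\<pi> b. isometric_rep G s \<pi> \<and> cocycle G s \<pi> b \<and>
        (\<forall>g\<in>carrier G. \<forall>v\<in>ell s. \<alpha> g v = (\<lambda>n. \<pi> g v n + b g n)))"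

definition property_F_ell :: "('a, 'b) monoid_scheme \<Rightarrow> real \<Rightarrow> bool" where
  "property_F_ell G s \<longleftrightarrow>
     (\<forall>\<alpha>. affine_isometric_action G s \<alpha> \<longrightarrow> (\<exists>v\<in>ell s. \<forall>g\<in>carrier G. \<alpha> g v = v))"

end

theory Submission
  imports Defs "HOL-Analysis.Convex"
begin

text \<open>
  For \<open>p \<noteq> 2\<close> the isometries of \<open>\<ell>\<^sub>p\<close> are signed permutations (Banach--Lamperti), and on the
  doubled index set \<open>\<nat> \<times> {\<plusminus>1}\<close> they become plain permutations, which act isometrically on every
  \<open>\<ell>\<^sub>s\<close>. An \<open>\<ell>\<^sub>p\<close>-cocycle \<open>c\<close> of such an action is also an \<open>\<ell>\<^sub>q\<close>-cocycle, so \<open>c g = v - g v\<close> with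
  \<open>v \<in> \<ell>\<^sub>q\<close>; subtracting constants on the finite orbits, we may assume that \<open>v\<close> has median \<open>0\<close> on
  each of them. Let \<open>w = sgn v \<bar>v\<bar>\<^bsup>p/q\<^esup>\<close>. Since \<open>t \<mapsto> sgn t \<bar>t\<bar>\<^bsup>p/q\<^esup>\<close> is \<open>p/q\<close>-Hoelder, \<open>w - g w\<close> is an
  \<open>\<ell>\<^sub>q\<close>-cocycle, hence \<open>w = w' + u\<close> with \<open>w' \<in> \<ell>\<^sub>q\<close> and \<open>u\<close> invariant. On an infinite orbit \<open>u\<close>
  vanishes because \<open>w\<close> and \<open>w'\<close> tend to \<open>0\<close>; on a finite orbit \<open>w\<close> has median \<open>0\<close>, so
  \<open>\<bar>u\<bar> \<le> \<bar>w'\<bar>\<close> on at least half of the points. Thus \<open>u\<close> and \<open>w\<close> are in \<open>\<ell>\<^sub>q\<close>, which means \<open>v \<in> \<ell>\<^sub>p\<close>.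
\<close>

section \<open>Power inequalities\<close>

text \<open>Write z^r as z * z^(r-1) and enlarge each second factor to (x+y)^(r-1).\<close>

lemma powr_add_strict_superadditive:
  fixes x y r :: real
  assumes "1 < r" "0 < x" "0 < y"
  shows "x powr r + y powr r < (x + y) powr r"
proof -
  have split: "z powr r = z * z powr (r - 1)" if "0 < z" for z :: real
    using that by (simp add: powr_mult_base)
  have "x * x powr (r - 1) < x * (x + y) powr (r - 1)"
    and "y * y powr (r - 1) < y * (x + y) powr (r - 1)"
    using assms by (auto intro!: powr_less_mono2)
  then have "x * x powr (r - 1) + y * y powr (r - 1) < (x + y) * (x + y) powr (r - 1)"
    by (simp add: distrib_right)
  then show ?thesis
    using assms by (simp add: split)
qed

text \<open>This is superadditivity for the exponent 1/r, applied to x^r and y^r.\<close>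

lemma powr_add_strict_subadditive:
  fixes x y r :: real
  assumes "0 < r" "r < 1" "0 < x" "0 < y"
  shows "(x + y) powr r < x powr r + y powr r"
proof -
  have "(x powr r) powr (1 / r) + (y powr r) powr (1 / r) < (x powr r + y powr r) powr (1 / r)"
    using assms by (intro powr_add_strict_superadditive) auto
  then have "(x + y) powr r < ((x powr r + y powr r) powr (1 / r)) powr r"
    using assms by (intro powr_less_mono2) (auto simp: powr_powr)
  then show ?thesis
    using assms by (simp add: powr_powr)
qed

text \<open>Midpoint convexity settles positive arguments. If one argument is 0, the claim becomes
  \<open>half\<close>, which rests on 2 * (1/2)^r \<le> 1.\<close>

lemma powr_midpoint_le:
  fixes u v r :: real
  assumes "1 \<le> r" "0 \<le> u" "0 \<le> v"
  shows "2 * ((u + v) / 2) powr r \<le> u powr r + v powr r"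
proof -
  have half: "2 * (w / 2) powr r \<le> w powr r" if "0 \<le> w" for w :: real
  proof -
    have "2 * (1 / 2) powr r \<le> 2 * (1 / 2 :: real) powr 1"
      using assms by (intro mult_left_mono powr_mono') auto
    then have "2 * (1 / 2) powr r \<le> (1::real)"
      by simp
    then have "w powr r * (2 * (1 / 2) powr r) \<le> w powr r * 1"
      by (intro mult_left_mono) auto
    then show ?thesis
      using that powr_mult[of w "1/2" r] by (simp add: mult.assoc)
  qed
  show ?thesis
  proof (cases "0 < u \<and> 0 < v")
    case True
    then show ?thesis
      using convex_onD[OF powr_convex[OF assms(1)], of "1/2" u v] by (simp add: field_simps)
  next
    case False
    with assms have "u = 0 \<or> v = 0" by auto
    then show ?thesis
      using half assms by auto
  qed
qed

lemma powr_midpoint_ge: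
  fixes u v r :: real
  assumes "0 < r" "r \<le> 1" "0 \<le> u" "0 \<le> v"
  shows "u powr r + v powr r \<le> 2 * ((u + v) / 2) powr r"
proof -
  have "2 * ((u powr r + v powr r) / 2) powr (1 / r)
      \<le> (u powr r) powr (1 / r) + (v powr r) powr (1 / r)"
    using assms by (intro powr_midpoint_le) auto
  then have "((u powr r + v powr r) / 2) powr (1 / r) \<le> (u + v) / 2"
    using assms by (simp add: powr_powr)
  then have "(((u powr r + v powr r) / 2) powr (1 / r)) powr r \<le> ((u + v) / 2) powr r"
    using assms by (intro powr_mono2) auto
  then show ?thesis
    using assms by (simp add: powr_powr)
qed

section \<open>Clarkson-type inequalities from the parallelogram law\<close>

lemma abs_powr_eq_square_powr: "\<bar>t\<bar> powr s = (t\<^sup>2) powr (s / 2)" for t s :: real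
proof (cases "t = 0")
  case False
  have "(t\<^sup>2) powr (s / 2) = (\<bar>t\<bar> powr 2) powr (s / 2)"
    by simp
  then show ?thesis
    by (simp only: powr_powr) simp
qed simp

text \<open>The mean of (a+b)^2 and (a-b)^2 is a^2 + b^2. Convexity of the power s/2 compares the
  right side with (a^2 + b^2)^(s/2), and superadditivity of that power does the rest, strictly when
  a and b are both nonzero.\<close>

lemma clarkson_gt_2:
  fixes a b s :: real
  assumes "2 < s"
  shows "2 * (\<bar>a\<bar> powr s + \<bar>b\<bar> powr s) \<le> \<bar>a + b\<bar> powr s + \<bar>a - b\<bar> powr s"
    and "a * b \<noteq> 0 \<Longrightarrow>
      2 * (\<bar>a\<bar> powr s + \<bar>b\<bar> powr s) < \<bar>a + b\<bar> powr s + \<bar>a - b\<bar> powr s"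
proof -
  have mid: "((a + b)\<^sup>2 + (a - b)\<^sup>2) / 2 = a\<^sup>2 + b\<^sup>2"
    by (simp add: power2_eq_square algebra_simps)
  have le: "2 * (a\<^sup>2 + b\<^sup>2) powr (s / 2) \<le> \<bar>a + b\<bar> powr s + \<bar>a - b\<bar> powr s"
    using powr_midpoint_le[of "s / 2" "(a + b)\<^sup>2" "(a - b)\<^sup>2"] assms
    by (simp only: abs_powr_eq_square_powr mid) simp
  show strict: "2 * (\<bar>a\<bar> powr s + \<bar>b\<bar> powr s) < \<bar>a + b\<bar> powr s + \<bar>a - b\<bar> powr s"
    if "a * b \<noteq> 0"
  proof -
    have "(a\<^sup>2) powr (s / 2) + (b\<^sup>2) powr (s / 2) < (a\<^sup>2 + b\<^sup>2) powr (s / 2)"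
      using assms that by (intro powr_add_strict_superadditive) auto
    then show ?thesis
      using le by (simp add: abs_powr_eq_square_powr)
  qed
  show "2 * (\<bar>a\<bar> powr s + \<bar>b\<bar> powr s) \<le> \<bar>a + b\<bar> powr s + \<bar>a - b\<bar> powr s"
    using strict by (cases "a * b = 0") auto
qed

text \<open>The mirror image: the power s/2 is now concave and subadditive, so both comparisons
  reverse.\<close>

lemma clarkson_lt_2:
  fixes a b s :: real
  assumes "0 < s" "s < 2"
  shows "\<bar>a + b\<bar> powr s + \<bar>a - b\<bar> powr s \<le> 2 * (\<bar>a\<bar> powr s + \<bar>b\<bar> powr s)"
    and "a * b \<noteq> 0 \<Longrightarrow>
      \<bar>a + b\<bar> powr s + \<bar>a - b\<bar> powr s < 2 * (\<bar>a\<bar> powr s + \<bar>b\<bar> powr s)"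
proof -
  have mid: "((a + b)\<^sup>2 + (a - b)\<^sup>2) / 2 = a\<^sup>2 + b\<^sup>2"
    by (simp add: power2_eq_square algebra_simps)
  have le: "\<bar>a + b\<bar> powr s + \<bar>a - b\<bar> powr s \<le> 2 * (a\<^sup>2 + b\<^sup>2) powr (s / 2)"
    using powr_midpoint_ge[of "s / 2" "(a + b)\<^sup>2" "(a - b)\<^sup>2"] assms
    by (simp only: abs_powr_eq_square_powr mid) simp
  show strict: "\<bar>a + b\<bar> powr s + \<bar>a - b\<bar> powr s < 2 * (\<bar>a\<bar> powr s + \<bar>b\<bar> powr s)"
    if "a * b \<noteq> 0"
  proof -
    have "(a\<^sup>2 + b\<^sup>2) powr (s / 2) < (a\<^sup>2) powr (s / 2) + (b\<^sup>2) powr (s / 2)"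
      using assms that by (intro powr_add_strict_subadditive) auto
    then show ?thesis
      using le by (simp add: abs_powr_eq_square_powr)
  qed
  show "\<bar>a + b\<bar> powr s + \<bar>a - b\<bar> powr s \<le> 2 * (\<bar>a\<bar> powr s + \<bar>b\<bar> powr s)"
    using strict by (cases "a * b = 0") auto
qed

lemma abs_add_powr_le:
  fixes a b s :: real
  assumes "0 \<le> s"
  shows "\<bar>a + b\<bar> powr s \<le> 2 powr s * (\<bar>a\<bar> powr s + \<bar>b\<bar> powr s)"
proof -
  have "\<bar>a + b\<bar> powr s \<le> (2 * max \<bar>a\<bar> \<bar>b\<bar>) powr s"
    using assms by (intro powr_mono2) auto
  also have "\<dots> = 2 powr s * max \<bar>a\<bar> \<bar>b\<bar> powr s"
    by (simp add: powr_mult)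
  also have "\<dots> \<le> 2 powr s * (\<bar>a\<bar> powr s + \<bar>b\<bar> powr s)"
    by (auto simp: max_def)
  finally show ?thesis .
qed

section \<open>The coordinate form of the Mazur map, and its Hoelder continuity\<close>

definition sgn_powr :: "real \<Rightarrow> real \<Rightarrow> real" where
  "sgn_powr \<alpha> t = sgn t * \<bar>t\<bar> powr \<alpha>"

lemma abs_sgn_powr: "\<bar>sgn_powr \<alpha> t\<bar> = \<bar>t\<bar> powr \<alpha>"
  by (simp add: sgn_powr_def abs_mult sgn_if)

lemma sgn_powr_nonneg: "0 \<le> t \<Longrightarrow> 0 \<le> sgn_powr \<alpha> t"
  by (simp add: sgn_powr_def)

lemma sgn_powr_nonpos: "t \<le> 0 \<Longrightarrow> sgn_powr \<alpha> t \<le> 0"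
  by (simp add: sgn_powr_def sgn_if)

text \<open>For equal signs subadditivity of the power gives the bound. For opposite signs |a| and
  |b| are both at most |a - b|, which accounts for the factor 2.\<close>

lemma sgn_powr_hoelder:
  fixes a b \<alpha> :: real
  assumes "0 < \<alpha>" "\<alpha> < 1"
  shows "\<bar>sgn_powr \<alpha> a - sgn_powr \<alpha> b\<bar> \<le> 2 * \<bar>a - b\<bar> powr \<alpha>"
proof -
  have sub: "(x + y) powr \<alpha> \<le> x powr \<alpha> + y powr \<alpha>" if "0 \<le> x" "0 \<le> y" for x y :: real
    using powr_add_strict_subadditive[of \<alpha> x y] assms that
    by (cases "x = 0 \<or> y = 0") auto
  have same: "\<bar>x powr \<alpha> - y powr \<alpha>\<bar> \<le> 2 * \<bar>x - y\<bar> powr \<alpha>" if "0 \<le> x" "0 \<le> y" for x y :: real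
  proof -
    have *: "z powr \<alpha> \<le> w powr \<alpha> \<and> w powr \<alpha> - z powr \<alpha> \<le> \<bar>w - z\<bar> powr \<alpha>"
      if "0 \<le> z" "z \<le> w" for w z :: real
      using sub[of "w - z" z] that assms by (auto intro: powr_mono2)
    have "0 \<le> \<bar>x - y\<bar> powr \<alpha>" by simp
    then show ?thesis
      using *[of x y] *[of y x] that by (cases "x \<le> y") (auto simp: abs_minus_commute)
  qed
  have opp: "x powr \<alpha> + y powr \<alpha> \<le> 2 * (x + y) powr \<alpha>" if "0 \<le> x" "0 \<le> y" for x y :: real
    using that assms powr_mono2[of \<alpha> x "x + y"] powr_mono2[of \<alpha> y "x + y"] by auto
  consider "0 \<le> a" "0 \<le> b" | "a \<le> 0" "b \<le> 0" | "0 \<le> a" "b \<le> 0" | "a \<le> 0" "0 \<le> b"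
    by linarith
  then show ?thesis
  proof cases
    case 1
    then show ?thesis using same[of a b] by (auto simp: sgn_powr_def sgn_if)
  next
    case 2
    then show ?thesis using same[of "-a" "-b"] by (auto simp: sgn_powr_def sgn_if abs_minus_commute)
  next
    case 3
    then show ?thesis using opp[of a "-b"] by (auto simp: sgn_powr_def sgn_if)
  next
    case 4
    have "\<bar>- ((- a) powr \<alpha>) - b powr \<alpha>\<bar> = (- a) powr \<alpha> + b powr \<alpha>"
      using powr_ge_zero[of "- a" \<alpha>] powr_ge_zero[of b \<alpha>] by linarith
    with 4 show ?thesis using opp[of "-a" b] by (auto simp: sgn_powr_def sgn_if)
  qed
qed

section \<open>The sequence spaces\<close>

lemma ell_D: "x \<in> ell s \<Longrightarrow> summable (\<lambda>n. \<bar>x n\<bar> powr s)"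
  by (simp add: ell_def)

text \<open>The exponents may differ, so that sequences can be moved between \<open>ell p\<close>
  and \<open>ell q\<close> along \<open>sgn_powr\<close>.\<close>

lemma ell_dominated:
  assumes "y \<in> ell s" "\<And>n. \<bar>x n\<bar> powr t \<le> C * \<bar>y n\<bar> powr s"
  shows "x \<in> ell t"
  unfolding ell_def mem_Collect_eq
  by (rule summable_comparison_test'[OF summable_mult[OF ell_D[OF assms(1)], of C]])
    (use assms(2) in auto)

lemma ell_cmult: "x \<in> ell s \<Longrightarrow> (\<lambda>n. c * x n) \<in> ell s"
  by (rule ell_dominated[where C = "\<bar>c\<bar> powr s"]) (auto simp: abs_mult powr_mult)

lemma ell_add:
  assumes "0 \<le> s" "x \<in> ell s" "y \<in> ell s"
  shows "(\<lambda>n. x n + y n) \<in> ell s"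
  unfolding ell_def mem_Collect_eq
  by (rule summable_comparison_test'[OF summable_mult[OF summable_add[OF ell_D ell_D]], of x s y])
    (use assms abs_add_powr_le in auto)

lemma ell_diff:
  assumes "0 \<le> s" "x \<in> ell s" "y \<in> ell s"
  shows "(\<lambda>n. x n - y n) \<in> ell s"
  using ell_add[OF assms(1,2) ell_cmult[OF assms(3), of "-1"]] by simp

lemma ell_finite_support: "finite {n. x n \<noteq> 0} \<Longrightarrow> x \<in> ell s"
  unfolding ell_def by (auto intro!: summable_finite[of "{n. x n \<noteq> 0}"])

lemma ell_finite_large:
  assumes "x \<in> ell s" "0 < s" "0 < \<epsilon>"
  shows "finite {n. \<epsilon> \<le> \<bar>x n\<bar>}"
proof -
  have "(\<lambda>n. \<bar>x n\<bar> powr s) \<longlonglongrightarrow> 0"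
    using assms ell_D summable_LIMSEQ_zero by blast
  then have "\<forall>\<^sub>F n in sequentially. \<bar>x n\<bar> powr s < \<epsilon> powr s"
    using assms by (intro order_tendstoD) auto
  then obtain N where N: "\<And>n. N \<le> n \<Longrightarrow> \<bar>x n\<bar> powr s < \<epsilon> powr s"
    by (auto simp: eventually_sequentially)
  have "n < N" if "\<epsilon> \<le> \<bar>x n\<bar>" for n
  proof (rule ccontr)
    assume "\<not> n < N"
    then have "\<bar>x n\<bar> powr s < \<epsilon> powr s" using N by auto
    moreover have "\<epsilon> powr s \<le> \<bar>x n\<bar> powr s" using that assms by (intro powr_mono2) auto
    ultimately show False by simp
  qed
  then show ?thesis
    by (auto intro: finite_subset[of _ "{..<N}"])
qed

text \<open>Only finitely many entries have modulus at least 1; beyond them a larger exponent makes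
  the terms smaller.\<close>

lemma ell_mono:
  assumes "x \<in> ell s" "0 < s" "s \<le> t"
  shows "x \<in> ell t"
proof -
  have "finite {n. 1 \<le> \<bar>x n\<bar>}"
    using assms by (intro ell_finite_large) auto
  then obtain N where N: "\<And>n. 1 \<le> \<bar>x n\<bar> \<Longrightarrow> n < N"
    using finite_nat_set_iff_bounded by auto
  have "norm (\<bar>x n\<bar> powr t) \<le> \<bar>x n\<bar> powr s" if "N \<le> n" for n
  proof -
    have "\<bar>x n\<bar> \<le> 1"
      using N[of n] that by linarith
    then show ?thesis
      using assms by (auto intro: powr_mono')
  qed
  then show ?thesis
    unfolding ell_def mem_Collect_eq
    by (rule summable_comparison_test'[OF ell_D[OF assms(1)]])
qed

lemma ell_reindex: "x \<in> ell s \<Longrightarrow> inj f \<Longrightarrow> (\<lambda>n. x (f n)) \<in> ell s"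
  unfolding ell_def using summable_reindex[of "\<lambda>n. \<bar>x n\<bar> powr s" f] by (auto simp: o_def)

lemma ell_norm_reindex:
  assumes "x \<in> ell s" "bij f"
  shows "ell_norm s (\<lambda>n. x (f n)) = ell_norm s x"
  unfolding ell_norm_def
  using suminf_reindex[of "\<lambda>n. \<bar>x n\<bar> powr s" f] assms ell_D
  by (auto simp: o_def bij_is_inj bij_is_surj)

lemma ell_norm_eqD:
  assumes "ell_norm s x = ell_norm s y" "0 < s" "x \<in> ell s" "y \<in> ell s"
  shows "(\<Sum>n. \<bar>x n\<bar> powr s) = (\<Sum>n. \<bar>y n\<bar> powr s)"
proof -
  have "ell_norm s z powr s = (\<Sum>n. \<bar>z n\<bar> powr s)" if "z \<in> ell s" for z
    using assms(2) suminf_nonneg[OF ell_D[OF that]] by (simp add: ell_norm_def powr_powr)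
  then show ?thesis
    using assms by metis
qed


section \<open>Isometries are signed permutations\<close>

text \<open>
  The right-hand side is expressed by norms, so linear isometries preserve disjointness of supports.
\<close>
lemma disjoint_support_iff:
  assumes "0 < s" "s \<noteq> 2" "x \<in> ell s" "y \<in> ell s"
  shows "(\<forall>n. x n * y n = 0) \<longleftrightarrow>
    (\<Sum>n. \<bar>x n + y n\<bar> powr s) + (\<Sum>n. \<bar>x n - y n\<bar> powr s)
      = 2 * ((\<Sum>n. \<bar>x n\<bar> powr s) + (\<Sum>n. \<bar>y n\<bar> powr s))"
    (is "_ \<longleftrightarrow> ?L = ?R")
proof -
  define l where "l n = \<bar>x n + y n\<bar> powr s + \<bar>x n - y n\<bar> powr s" for n
  define r where "r n = 2 * (\<bar>x n\<bar> powr s + \<bar>y n\<bar> powr s)" for n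
  have sum: "summable (\<lambda>n. \<bar>x n + y n\<bar> powr s)" "summable (\<lambda>n. \<bar>x n - y n\<bar> powr s)"
    "summable (\<lambda>n. \<bar>x n\<bar> powr s)" "summable (\<lambda>n. \<bar>y n\<bar> powr s)"
    using assms ell_add[of s x y] ell_diff[of s x y] by (auto dest: ell_D)
  have l: "summable l" "?L = suminf l"
    unfolding l_def using sum by (auto intro: summable_add suminf_add)
  have r: "summable r" "?R = suminf r"
    unfolding r_def using sum
    by (auto simp: suminf_mult suminf_add[symmetric] intro!: summable_mult summable_add)
  have eq: "l n = r n" if "x n * y n = 0" for n
    using that by (auto simp: l_def r_def)
  \<comment> \<open>The Clarkson inequality gives all terms of the difference the same sign, so
    equal sums force equality term by term; the strict form then excludes a nonzero product.\<close>
  have "\<forall>n. x n * y n = 0" if "suminf l = suminf r"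
  proof (cases "2 < s")
    case True
    have "suminf (\<lambda>n. l n - r n) = 0"
      using that l r by (simp add: suminf_diff[symmetric])
    moreover have "0 \<le> l n - r n" for n
      using clarkson_gt_2(1)[OF True, of "x n" "y n"] by (simp add: l_def r_def)
    ultimately have "\<forall>n. l n - r n = 0"
      using suminf_eq_zero_iff[OF summable_diff[OF l(1) r(1)]] by simp
    then show ?thesis
      using clarkson_gt_2(2)[OF True] unfolding l_def r_def by (metis eq_iff_diff_eq_0 less_irrefl)
  next
    case False
    with assms have s: "s < 2" by simp
    have "suminf (\<lambda>n. r n - l n) = 0"
      using that l r by (simp add: suminf_diff[symmetric])
    moreover have "0 \<le> r n - l n" for n
      using clarkson_lt_2(1)[OF assms(1) s, of "x n" "y n"] by (simp add: l_def r_def)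
    ultimately have "\<forall>n. r n - l n = 0"
      using suminf_eq_zero_iff[OF summable_diff[OF r(1) l(1)]] by simp
    then show ?thesis
      using clarkson_lt_2(2)[OF assms(1) s] unfolding l_def r_def
      by (metis eq_iff_diff_eq_0 less_irrefl)
  qed
  moreover have "suminf l = suminf r" if "\<forall>n. x n * y n = 0"
    using eq that by presburger
  ultimately show ?thesis
    using l(2) r(2) by metis
qed

definition unit_seq :: "nat \<Rightarrow> nat \<Rightarrow> real" where
  "unit_seq n m = (if m = n then 1 else 0)"

lemma unit_seq_in_ell: "unit_seq n \<in> ell s"
  by (rule ell_finite_support) (simp add: unit_seq_def)

text \<open>With \<open>True\<close> standing for -1, the product of signs becomes exclusive
  or.\<close>

definition bool_sign :: "bool \<Rightarrow> real" where
  "bool_sign b = (if b then - 1 else 1)"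

lemma bool_sign_mult: "bool_sign a * bool_sign b = bool_sign (a \<noteq> b)"
  by (simp add: bool_sign_def)

lemma bool_sign_unit_seq_inject:
  assumes "(\<lambda>m. bool_sign a * unit_seq k m) = (\<lambda>m. bool_sign b * unit_seq l m)"
  shows "k = l \<and> a = b"
proof -
  have "bool_sign a * unit_seq k k = bool_sign b * unit_seq l k"
    using assms by meson
  then show ?thesis
    by (auto simp: unit_seq_def bool_sign_def split: if_splits)
qed

text \<open>The first clause determines the index map and the signs, and makes compositions
  computable. The second describes \<open>T x\<close> for every x without a density argument.
  Bijectivity of the index map comes later, from the group law.\<close>

definition signed_perm ::
    "real \<Rightarrow> ((nat \<Rightarrow> real) \<Rightarrow> nat \<Rightarrow> real) \<Rightarrow> (nat \<Rightarrow> nat) \<Rightarrow> (nat \<Rightarrow> bool) \<Rightarrow> bool" where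
  "signed_perm s T \<sigma> \<beta> \<longleftrightarrow>
    (\<forall>n. T (unit_seq n) = (\<lambda>m. bool_sign (\<beta> n) * unit_seq (\<sigma> n) m)) \<and>
    (\<forall>x\<in>ell s. \<forall>n. T x (\<sigma> n) = bool_sign (\<beta> n) * x n)"

text \<open>T preserves and reflects disjointness of supports. With surjectivity this forces the
  image of a unit sequence to be a multiple of a unit sequence, and the norm leaves only the factors
  1 and -1.\<close>

lemma banach_lamperti:
  assumes "0 < s" "s \<noteq> 2" "ell_linear s T" "ell_isometry s T" "bij_betw T (ell s) (ell s)"
  shows "\<exists>\<sigma> \<beta>. signed_perm s T \<sigma> \<beta>"
proof -
  have s: "0 \<le> s" using assms by simp
  have in_ell: "T x \<in> ell s" if "x \<in> ell s" for x
    using that assms(5) by (auto simp: bij_betw_def)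
  have T_add: "T (\<lambda>n. x n + y n) = (\<lambda>n. T x n + T y n)" if "x \<in> ell s" "y \<in> ell s" for x y
    using assms(3) that by (auto simp: ell_linear_def)
  have T_cmult: "T (\<lambda>n. c * x n) = (\<lambda>n. c * T x n)" if "x \<in> ell s" for x c
    using assms(3) that by (auto simp: ell_linear_def)
  have T_diff: "T (\<lambda>n. x n - y n) = (\<lambda>n. T x n - T y n)" if "x \<in> ell s" "y \<in> ell s" for x y
    using T_add[OF that(1) ell_cmult[OF that(2), of "-1"]] T_cmult[OF that(2), of "-1"] by simp
  have norm: "(\<Sum>n. \<bar>T x n\<bar> powr s) = (\<Sum>n. \<bar>x n\<bar> powr s)" if "x \<in> ell s" for x
  proof -
    have 0: "(\<lambda>n. 0) \<in> ell s"
      by (simp add: ell_finite_support)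
    then have "T (\<lambda>n. 0) = (\<lambda>n. 0)"
      using T_cmult[of "\<lambda>n. 0" 0] by simp
    then have "ell_norm s (T x) = ell_norm s x"
      using assms(4) that 0 unfolding ell_isometry_def by force
    then show ?thesis
      using ell_norm_eqD assms(1) that in_ell by blast
  qed
  have disjoint: "(\<forall>n. T x n * T y n = 0) \<longleftrightarrow> (\<forall>n. x n * y n = 0)"
    if "x \<in> ell s" "y \<in> ell s" for x y
    using norm[OF that(1)] norm[OF that(2)] norm[OF ell_add[OF s that]] norm[OF ell_diff[OF s that]]
      disjoint_support_iff[OF assms(1,2) that] that
      disjoint_support_iff[OF assms(1,2) in_ell[OF that(1)] in_ell[OF that(2)]]
    by (simp add: T_add T_diff)
  have "\<exists>k b. T (unit_seq n) = (\<lambda>m. bool_sign b * unit_seq k m)" for n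
  proof -
    \<comment> \<open>A sequence is zero exactly when it is disjoint from itself.\<close>
    have "\<exists>m. T (unit_seq n) m \<noteq> 0"
    proof (rule ccontr)
      assume "\<nexists>m. T (unit_seq n) m \<noteq> 0"
      then have "\<forall>k. unit_seq n k * unit_seq n k = 0"
        using disjoint[of "unit_seq n" "unit_seq n"] unit_seq_in_ell by auto
      then have "unit_seq n n * unit_seq n n = 0" by blast
      then show False by (simp add: unit_seq_def)
    qed
    then obtain m where m: "T (unit_seq n) m \<noteq> 0" by blast
    obtain z where z: "z \<in> ell s" "T z = unit_seq m"
      using bij_betw_imp_surj_on[OF assms(5)] unit_seq_in_ell[of m s] by (metis imageE)
    \<comment> \<open>\<open>T (unit_seq k)\<close> is disjoint from \<open>T (unit_seq n)\<close>,
      so it vanishes at m and is disjoint from \<open>T z\<close>; reflecting this back gives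
      \<open>z k = 0\<close>.\<close>
    have "z k = 0" if "k \<noteq> n" for k
    proof -
      have "\<forall>j. unit_seq k j * unit_seq n j = 0"
        using that by (simp add: unit_seq_def)
      then have "T (unit_seq k) m * T (unit_seq n) m = 0"
        using disjoint[of "unit_seq k" "unit_seq n"] unit_seq_in_ell by blast
      with m have "\<forall>j. T z j * T (unit_seq k) j = 0"
        by (simp add: z unit_seq_def)
      then have "z k * unit_seq k k = 0"
        using disjoint[of z "unit_seq k"] z unit_seq_in_ell by blast
      then show ?thesis by (simp add: unit_seq_def)
    qed
    then have z_eq: "z = (\<lambda>k. z n * unit_seq n k)"
      by (auto simp: unit_seq_def fun_eq_iff)
    have "unit_seq m = (\<lambda>k. z n * T (unit_seq n) k)"
      using z(2) T_cmult[OF unit_seq_in_ell, of "z n" n] by (simp flip: z_eq)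
    then have T_unit: "unit_seq m k = z n * T (unit_seq n) k" for k
      by meson
    have norm_unit: "(\<Sum>k. \<bar>c * unit_seq j k\<bar> powr s) = \<bar>c\<bar> powr s" for c j
    proof -
      have "(\<Sum>k. \<bar>c * unit_seq j k\<bar> powr s) = (\<Sum>k\<in>{j}. \<bar>c * unit_seq j k\<bar> powr s)"
        by (rule suminf_finite) (auto simp: unit_seq_def)
      then show ?thesis by (simp add: unit_seq_def)
    qed
    have "\<bar>z n\<bar> powr s = (\<Sum>k. \<bar>z k\<bar> powr s)"
      using norm_unit[of "z n" n] z_eq by metis
    also have "\<dots> = 1"
      using norm[OF z(1)] norm_unit[of 1 m] z(2) by simp
    finally have "\<bar>z n\<bar> powr s = 1" .
    then have "(\<bar>z n\<bar> powr s) powr (1 / s) = 1"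
      by simp
    then have "\<bar>z n\<bar> = 1"
      using assms(1) by (simp add: powr_powr)
    then have "z n = 1 \<or> z n = - 1" by linarith
    \<comment> \<open>The scalar \<open>z n\<close> is 1 or -1, hence its own inverse.\<close>
    then have "T (unit_seq n) = (\<lambda>k. bool_sign (z n = - 1) * unit_seq m k)"
      by (auto simp: T_unit bool_sign_def)
    then show ?thesis by blast
  qed
  then obtain \<sigma> \<beta>
    where unit: "\<And>n. T (unit_seq n) = (\<lambda>m. bool_sign (\<beta> n) * unit_seq (\<sigma> n) m)"
    by metis
  have "T x (\<sigma> n) = bool_sign (\<beta> n) * x n" if x: "x \<in> ell s" for x n
  proof -
    have e: "(\<lambda>k. x n * unit_seq n k) \<in> ell s"
      using unit_seq_in_ell by (rule ell_cmult)
    \<comment> \<open>Deleting coordinate n makes y disjoint from \<open>unit_seq n\<close>, so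
      \<open>T y\<close> vanishes at \<open>\<sigma> n\<close> and only the deleted term contributes
      to \<open>T x\<close> there.\<close>
    define y where "y k = x k - x n * unit_seq n k" for k
    have y: "y \<in> ell s"
      unfolding y_def using x e by (rule ell_diff[OF s])
    have "\<forall>k. y k * unit_seq n k = 0"
      by (simp add: y_def unit_seq_def)
    then have "T y (\<sigma> n) * T (unit_seq n) (\<sigma> n) = 0"
      using disjoint y unit_seq_in_ell by blast
    then have "T y (\<sigma> n) = 0"
      by (auto simp: unit bool_sign_def unit_seq_def split: if_splits)
    moreover have "T y = (\<lambda>k. T x k - x n * T (unit_seq n) k)"
      unfolding y_def by (simp add: T_diff[OF x e] T_cmult[OF unit_seq_in_ell])
    ultimately show ?thesis
      by (simp add: unit unit_seq_def)
  qed
  with unit show ?thesis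
    unfolding signed_perm_def by blast
qed

text \<open>Evaluate on unit sequences and pull the inner sign out by linearity. The signs thus form
  a cocycle over the index maps: the outer sign is read at the index already moved by
  \<open>\<sigma>2\<close>.\<close>

lemma signed_perm_compose:
  assumes "signed_perm s T \<sigma> \<beta>" "signed_perm s T1 \<sigma>1 \<beta>1" "signed_perm s T2 \<sigma>2 \<beta>2"
    and "ell_linear s T1" "\<And>x. x \<in> ell s \<Longrightarrow> T x = T1 (T2 x)"
  shows "\<sigma> n = \<sigma>1 (\<sigma>2 n)" "\<beta> n \<longleftrightarrow> (\<beta>1 (\<sigma>2 n) \<noteq> \<beta>2 n)"
proof -
  have unit: "T (unit_seq k) = (\<lambda>m. bool_sign (\<beta> k) * unit_seq (\<sigma> k) m)"
    "T1 (unit_seq k) = (\<lambda>m. bool_sign (\<beta>1 k) * unit_seq (\<sigma>1 k) m)"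
    "T2 (unit_seq k) = (\<lambda>m. bool_sign (\<beta>2 k) * unit_seq (\<sigma>2 k) m)" for k
    using assms(1-3) unfolding signed_perm_def by blast+
  have "T (unit_seq n) = T1 (T2 (unit_seq n))"
    using assms(5) unit_seq_in_ell by blast
  also have "\<dots> = T1 (\<lambda>m. bool_sign (\<beta>2 n) * unit_seq (\<sigma>2 n) m)"
    by (simp only: unit)
  also have "\<dots> = (\<lambda>m. bool_sign (\<beta>2 n) * T1 (unit_seq (\<sigma>2 n)) m)"
    using assms(4) unit_seq_in_ell unfolding ell_linear_def by blast
  also have "\<dots> = (\<lambda>m. bool_sign (\<beta>2 n \<noteq> \<beta>1 (\<sigma>2 n)) * unit_seq (\<sigma>1 (\<sigma>2 n)) m)"
    by (simp only: unit bool_sign_mult mult.assoc[symmetric])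
  finally have "\<sigma> n = \<sigma>1 (\<sigma>2 n) \<and> \<beta> n = (\<beta>2 n \<noteq> \<beta>1 (\<sigma>2 n))"
    unfolding unit by (rule bool_sign_unit_seq_inject)
  then show "\<sigma> n = \<sigma>1 (\<sigma>2 n)" "\<beta> n \<longleftrightarrow> (\<beta>1 (\<sigma>2 n) \<noteq> \<beta>2 n)"
    by auto
qed


section \<open>Permutation actions\<close>

text \<open>Each \<open>f g\<close> is bijective because \<open>f (inv g)\<close> inverts it.
  Restriction yields the extensional representative that \<open>Bij\<close> demands.\<close>

lemma (in group) restrict_hom_BijGroup:
  assumes "\<And>g x. g \<in> carrier G \<Longrightarrow> x \<in> E \<Longrightarrow> f g x \<in> E"
    and one: "\<And>x. x \<in> E \<Longrightarrow> f \<one> x = x"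
    and mult: "\<And>g h x. g \<in> carrier G \<Longrightarrow> h \<in> carrier G \<Longrightarrow> x \<in> E \<Longrightarrow> f (g \<otimes> h) x = f g (f h x)"
  shows "(\<lambda>g. restrict (f g) E) \<in> hom G (BijGroup E)"
proof -
  have inverse: "f g (f (inv g) x) = x" "f (inv g) (f g x) = x" if "g \<in> carrier G" "x \<in> E" for g x
    using that mult[of g "inv g" x] mult[of "inv g" g x] one by simp_all
  have Bij: "restrict (f g) E \<in> Bij E" if "g \<in> carrier G" for g
  proof -
    have "bij_betw (f g) E E"
      using that assms(1) inverse by (intro bij_betw_byWitness[where f' = "f (inv g)"]) auto
    then show ?thesis
      by (auto simp: Bij_def cong: bij_betw_cong)
  qed
  show ?thesis
  proof (rule homI)
    show "restrict (f g) E \<in> carrier (BijGroup E)" if "g \<in> carrier G" for g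
      using Bij[OF that] by (simp add: BijGroup_def)
    show "restrict (f (g \<otimes> h)) E = restrict (f g) E \<otimes>\<^bsub>BijGroup E\<^esub> restrict (f h) E"
      if "g \<in> carrier G" "h \<in> carrier G" for g h
      using that Bij mult assms(1) by (auto simp: BijGroup_def compose_def fun_eq_iff)
  qed
qed

lemma (in group) group_action_UNIV:
  assumes "\<And>x. \<rho> \<one> x = x"
    and "\<And>g h x. g \<in> carrier G \<Longrightarrow> h \<in> carrier G \<Longrightarrow> \<rho> (g \<otimes> h) x = \<rho> g (\<rho> h x)"
  shows "group_action G UNIV \<rho>"
  using restrict_hom_BijGroup[of UNIV \<rho>] assms group_BijGroup is_group
  by (simp add: group_action_def group_hom_def group_hom_axioms_def restrict_def)

text \<open>Reindexing along \<open>inv g\<close> turns the action on indices into a left action by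
  linear isometries. A fixed point of the affine action with translation part c is the required
  v.\<close>

lemma permutation_cocycle_coboundary:
  fixes G (structure) and \<rho> :: "'a \<Rightarrow> nat \<Rightarrow> nat"
  assumes "group G" "group_action G UNIV \<rho>" "0 < s" "property_F_ell G s"
    and c_ell: "\<And>g. g \<in> carrier G \<Longrightarrow> c g \<in> ell s"
    and c_mult: "\<And>g h n. g \<in> carrier G \<Longrightarrow> h \<in> carrier G \<Longrightarrow>
      c (g \<otimes> h) n = c h (\<rho> (inv g) n) + c g n"
  shows "\<exists>v\<in>ell s. \<forall>g\<in>carrier G. \<forall>n. c g n = v n - v (\<rho> (inv g) n)"
proof -
  interpret group G by fact
  interpret group_action G UNIV \<rho> by fact
  have s: "0 \<le> s" using assms by simp
  define L where "L g v n = v (\<rho> (inv g) n)" for g n and v :: "nat \<Rightarrow> real"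
  define A where "A g v n = L g v n + c g n" for g n and v :: "nat \<Rightarrow> real"
  have bij: "bij (\<rho> g)" if "g \<in> carrier G" for g
    using bij_prop0[OF that] by (simp add: Bij_def)
  have rho_one: "\<rho> \<one> n = n" for n
    using fun_cong[OF id_eq_one, of n] by simp
  have rho_mult: "\<rho> (inv (g \<otimes> h)) n = \<rho> (inv h) (\<rho> (inv g) n)"
    if "g \<in> carrier G" "h \<in> carrier G" for g h n
    using that by (simp add: inv_mult_group composition_rule)
  have L_ell: "L g v \<in> ell s" if "g \<in> carrier G" "v \<in> ell s" for g v
    unfolding L_def by (rule ell_reindex[OF that(2) bij_is_inj[OF bij[OF inv_closed[OF that(1)]]]])
  have A_ell: "A g v \<in> ell s" if "g \<in> carrier G" "v \<in> ell s" for g v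
    unfolding A_def by (rule ell_add[OF s L_ell[OF that] c_ell[OF that(1)]])
  have L_one: "L \<one> v = v" for v
    by (simp add: L_def rho_one fun_eq_iff)
  have L_mult: "L (g \<otimes> h) v = L g (L h v)" if "g \<in> carrier G" "h \<in> carrier G" for g h v
    using that by (simp add: L_def rho_mult fun_eq_iff)
  have c_one: "c \<one> n = 0" for n
    using c_mult[of \<one> \<one> n] rho_one by simp
  have A_one: "A \<one> v = v" for v
    by (simp add: A_def L_one c_one fun_eq_iff)
  have A_mult: "A (g \<otimes> h) v = A g (A h v)" if "g \<in> carrier G" "h \<in> carrier G" for g h v
    using that by (simp add: A_def L_mult c_mult fun_eq_iff L_def)
  define \<pi> where "\<pi> g = restrict (L g) (ell s)" for g
  define \<alpha> where "\<alpha> g = restrict (A g) (ell s)" for g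
  have \<alpha>: "group_action G (ell s) \<alpha>"
    unfolding \<alpha>_def group_action_def group_hom_def group_hom_axioms_def
    using restrict_hom_BijGroup[of "ell s" A] A_ell A_one A_mult group_BijGroup is_group by blast
  have hom: "\<pi> \<in> hom G (BijGroup (ell s))"
    unfolding \<pi>_def using restrict_hom_BijGroup[of "ell s" L] L_ell L_one L_mult by blast
  have "ell_linear s (\<pi> g)" if "g \<in> carrier G" for g
    using ell_add[OF s] ell_cmult by (auto simp: ell_linear_def \<pi>_def L_def)
  moreover have "ell_isometry s (\<pi> g)" if "g \<in> carrier G" for g
    using ell_norm_reindex[OF ell_diff[OF s] bij] that
    by (simp add: ell_isometry_def \<pi>_def L_def)
  \<comment> \<open>\<open>ell_O s\<close> has the multiplication of \<open>BijGroup\<close>, so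
    only membership in its smaller carrier had to be added.\<close>
  ultimately have "isometric_rep G s \<pi>"
    using hom unfolding isometric_rep_def ell_O_def hom_def by (auto simp: BijGroup_def)
  moreover have "cocycle G s \<pi> c"
    using c_ell c_mult by (auto simp: cocycle_def \<pi>_def L_def fun_eq_iff)
  moreover have "\<forall>g\<in>carrier G. \<forall>v\<in>ell s. \<alpha> g v = (\<lambda>n. \<pi> g v n + c g n)"
    by (simp add: \<alpha>_def \<pi>_def A_def fun_eq_iff)
  ultimately obtain v where v: "v \<in> ell s" "\<And>g. g \<in> carrier G \<Longrightarrow> \<alpha> g v = v"
    using assms(4) \<alpha> unfolding property_F_ell_def affine_isometric_action_def by blast
  have "c g n = v n - v (\<rho> (inv g) n)" if "g \<in> carrier G" for g n
    using fun_cong[OF v(2)[OF that], of n] v(1) by (simp add: \<alpha>_def A_def L_def)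
  with v(1) show ?thesis by blast
qed

section \<open>Medians\<close>

text \<open>Take the least value t of f such that at least half of the points satisfy f \<le> t.
  Fewer than half lie strictly below it, since otherwise the largest value attained there would be a
  smaller candidate.\<close>

lemma median_exists:
  fixes f :: "'b \<Rightarrow> real"
  assumes "finite A"
  shows "\<exists>c. card A \<le> 2 * card {a \<in> A. f a \<le> c} \<and> card A \<le> 2 * card {a \<in> A. c \<le> f a}"
proof (cases "A = {}")
  case False
  define S where "S = {t \<in> f ` A. card A \<le> 2 * card {a \<in> A. f a \<le> t}}"
  have "{a \<in> A. f a \<le> Max (f ` A)} = A"
    using assms by auto
  then have "Max (f ` A) \<in> S"
    using assms False by (simp add: S_def)
  moreover have "finite S"
    using assms by (simp add: S_def)
  ultimately have c: "Min S \<in> S" and min: "\<And>t. t \<in> S \<Longrightarrow> Min S \<le> t"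
    by (auto intro: Min_in)
  define B where "B = {a \<in> A. f a < Min S}"
  have "2 * card B < card A"
  proof (rule ccontr)
    assume *: "\<not> 2 * card B < card A"
    then have "B \<noteq> {}"
      using assms False by auto
    moreover have "finite B"
      using assms by (simp add: B_def)
    ultimately have m: "Max (f ` B) \<in> f ` B" "\<And>a. a \<in> B \<Longrightarrow> f a \<le> Max (f ` B)"
      by auto
    then have "{a \<in> A. f a \<le> Max (f ` B)} = B"
      by (auto simp: B_def)
    with * m(1) have "Max (f ` B) \<in> S"
      by (auto simp: S_def B_def)
    then have "Min S \<le> Max (f ` B)"
      by (rule min)
    moreover obtain a where "Max (f ` B) = f a" "a \<in> B"
      using m(1) by (rule imageE)
    moreover from this have "f a < Min S"
      by (simp add: B_def)
    ultimately show False by simp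
  qed
  moreover have "card A = card B + card {a \<in> A. Min S \<le> f a}"
  proof -
    have "card (B \<union> {a \<in> A. Min S \<le> f a}) = card B + card {a \<in> A. Min S \<le> f a}"
      using assms by (intro card_Un_disjoint) (auto simp: B_def)
    moreover have "B \<union> {a \<in> A. Min S \<le> f a} = A"
      by (auto simp: B_def)
    ultimately show ?thesis by simp
  qed
  ultimately have "card A \<le> 2 * card {a \<in> A. Min S \<le> f a}"
    by linarith
  moreover have "card A \<le> 2 * card {a \<in> A. f a \<le> Min S}"
    using c by (simp add: S_def)
  ultimately show ?thesis by blast
qed auto

text \<open>Where w is 0 or has the sign opposite to k, |w'| is at least |k|; the median condition
  says that this covers half of A.\<close>

lemma median_shift_bound:
  fixes w w' :: "'b \<Rightarrow> real"
  assumes "finite A" "card A \<le> 2 * card {a \<in> A. w a \<le> 0}" "card A \<le> 2 * card {a \<in> A. 0 \<le> w a}"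
    and "\<And>a. a \<in> A \<Longrightarrow> w a - w' a = k" and "0 \<le> s"
  shows "real (card A) * \<bar>k\<bar> powr s \<le> 2 * (\<Sum>a\<in>A. \<bar>w' a\<bar> powr s)"
proof -
  have "\<exists>B\<subseteq>A. card A \<le> 2 * card B \<and> (\<forall>a\<in>B. \<bar>k\<bar> \<le> \<bar>w' a\<bar>)"
  proof (cases "0 \<le> k")
    case True
    have "\<bar>k\<bar> \<le> \<bar>w' a\<bar>" if "a \<in> {a \<in> A. w a \<le> 0}" for a
      using that assms(4)[of a] True by auto
    then show ?thesis
      using assms(2) by (intro exI[of _ "{a \<in> A. w a \<le> 0}"]) auto
  next
    case False
    have "\<bar>k\<bar> \<le> \<bar>w' a\<bar>" if "a \<in> {a \<in> A. 0 \<le> w a}" for a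
      using that assms(4)[of a] False by auto
    then show ?thesis
      using assms(3) by (intro exI[of _ "{a \<in> A. 0 \<le> w a}"]) auto
  qed
  then obtain B where B: "B \<subseteq> A" "card A \<le> 2 * card B" "\<And>a. a \<in> B \<Longrightarrow> \<bar>k\<bar> \<le> \<bar>w' a\<bar>"
    by blast
  have "real (card A) * \<bar>k\<bar> powr s \<le> real (2 * card B) * \<bar>k\<bar> powr s"
    using B(2) by (intro mult_right_mono) auto
  also have "\<dots> = 2 * (\<Sum>a\<in>B. \<bar>k\<bar> powr s)"
    by simp
  also have "\<dots> \<le> 2 * (\<Sum>a\<in>B. \<bar>w' a\<bar> powr s)"
    using B(3) assms(5) by (intro mult_left_mono sum_mono powr_mono2) auto
  also have "\<dots> \<le> 2 * (\<Sum>a\<in>A. \<bar>w' a\<bar> powr s)"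
    using B(1) assms(1) by (intro mult_left_mono sum_mono2) auto
  finally show ?thesis .
qed


section \<open>Lowering the exponent of a permutation cocycle\<close>

text \<open>The fixed-point property at q is applied twice: to c, seen in \<open>ell q\<close>, and
  to the cocycle \<open>d\<close> built from the transformed primitive \<open>w\<close>.\<close>

lemma permutation_cocycle_coboundary_lower:
  fixes G (structure) and \<rho> :: "'a \<Rightarrow> nat \<Rightarrow> nat"
  assumes "group G" "group_action G UNIV \<rho>" "0 < p" "p < q" "property_F_ell G q"
    and c_ell: "\<And>g. g \<in> carrier G \<Longrightarrow> c g \<in> ell p"
    and c_mult: "\<And>g h n. g \<in> carrier G \<Longrightarrow> h \<in> carrier G \<Longrightarrow>
      c (g \<otimes> h) n = c h (\<rho> (inv g) n) + c g n"
  shows "\<exists>v\<in>ell p. \<forall>g\<in>carrier G. \<forall>n. c g n = v n - v (\<rho> (inv g) n)"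
proof -
  interpret group G by fact
  interpret group_action G UNIV \<rho> by fact
  have q: "0 < q" using assms by simp
  have coboundary: "\<exists>v\<in>ell q. \<forall>g\<in>carrier G. \<forall>n. a g n = v n - v (\<rho> (inv g) n)"
    if "\<And>g. g \<in> carrier G \<Longrightarrow> a g \<in> ell q"
      and "\<And>g h n. g \<in> carrier G \<Longrightarrow> h \<in> carrier G \<Longrightarrow> a (g \<otimes> h) n = a h (\<rho> (inv g) n) + a g n"
    for a :: "'a \<Rightarrow> nat \<Rightarrow> real"
    using permutation_cocycle_coboundary[OF assms(1,2) q assms(5)] that by blast
  obtain V where V: "V \<in> ell q" "\<And>g n. g \<in> carrier G \<Longrightarrow> c g n = V n - V (\<rho> (inv g) n)"
    using coboundary[of c] ell_mono[OF c_ell assms(3)] c_mult assms(4) by force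
  define Orb where "Orb n = orbit G \<rho> n" for n
  have Orb_refl: "n \<in> Orb n" for n
    by (simp add: Orb_def orbit_refl)
  have Orb_eq: "Orb m = Orb n" if "m \<in> Orb n" for m n
    using that orbit_sym[of n m] orbit_trans unfolding Orb_def by blast
  have act_Orb: "\<rho> g n \<in> Orb n" if "g \<in> carrier G" for g n
    using that by (auto simp: Orb_def orbit_def)

  \<comment> \<open>The chosen median depends only on the set \<open>Orb n\<close>, so C is constant
    on orbits and subtracting it does not change the coboundary. On infinite orbits the value 0
    keeps V as it is, so its decay is not lost.\<close>
  define C where "C n = (if finite (Orb n) then (SOME t.
      card (Orb n) \<le> 2 * card {a \<in> Orb n. V a \<le> t} \<and>
      card (Orb n) \<le> 2 * card {a \<in> Orb n. t \<le> V a}) else 0)" for n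
  have C_median: "card (Orb n) \<le> 2 * card {a \<in> Orb n. V a \<le> C n} \<and>
      card (Orb n) \<le> 2 * card {a \<in> Orb n. C n \<le> V a}" if "finite (Orb n)" for n
    using someI_ex[OF median_exists[OF that, of V]] that by (simp add: C_def)
  have C_Orb: "C m = C n" if "m \<in> Orb n" for m n
    using Orb_eq[OF that] by (simp add: C_def)
  define v where "v n = V n - C n" for n
  have c_v: "c g n = v n - v (\<rho> (inv g) n)" if "g \<in> carrier G" for g n
    using V(2) that C_Orb[OF act_Orb] by (simp add: v_def)

  \<comment> \<open>The exponent makes |w n|^q = |v n|^p, so \<open>w \<in> ell q\<close> will give
    \<open>v \<in> ell p\<close>.\<close>
  define w where "w n = sgn_powr (p / q) (v n)" for n
  have abs_w: "\<bar>w n\<bar> = \<bar>v n\<bar> powr (p / q)" for n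
    by (simp add: w_def abs_sgn_powr)
  define d where "d g n = w n - w (\<rho> (inv g) n)" for g n
  \<comment> \<open>Here the full strength of \<open>c g \<in> ell p\<close> enters, through Hoelder
    continuity with exponent p/q.\<close>
  have d_ell: "d g \<in> ell q" if g: "g \<in> carrier G" for g
  proof (rule ell_dominated[OF c_ell[OF g]])
    fix n
    have "\<bar>d g n\<bar> \<le> 2 * \<bar>c g n\<bar> powr (p / q)"
      using assms sgn_powr_hoelder[of "p / q" "v n" "v (\<rho> (inv g) n)"]
      by (simp add: d_def w_def c_v[OF g])
    then have "\<bar>d g n\<bar> powr q \<le> (2 * \<bar>c g n\<bar> powr (p / q)) powr q"
      using q by (intro powr_mono2) auto
    also have "\<dots> = 2 powr q * \<bar>c g n\<bar> powr p"
      using q by (simp add: powr_mult powr_powr)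
    finally show "\<bar>d g n\<bar> powr q \<le> 2 powr q * \<bar>c g n\<bar> powr p" .
  qed
  have d_mult: "d (g \<otimes> h) n = d h (\<rho> (inv g) n) + d g n"
    if "g \<in> carrier G" "h \<in> carrier G" for g h n
    using that by (simp add: d_def inv_mult_group composition_rule)
  obtain w' where w': "w' \<in> ell q" "\<And>g n. g \<in> carrier G \<Longrightarrow> d g n = w' n - w' (\<rho> (inv g) n)"
    using coboundary[of d] d_ell d_mult by blast
  \<comment> \<open>The difference of two primitives of the same cocycle is invariant.\<close>
  define U where "U n = w n - w' n" for n
  have "U (\<rho> g n) = U n" if "g \<in> carrier G" for g n
    using w'(2)[of "inv g" n] that by (simp add: d_def U_def)
  then have U_Orb: "U m = U n" if "m \<in> Orb n" for m n
    using that by (auto simp: Orb_def orbit_def)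

  have U_infinite: "U n = 0" if inf: "infinite (Orb n)" for n
  proof (rule ccontr)
    assume "U n \<noteq> 0"
    then have pos: "0 < \<bar>U n\<bar> / 2" by simp
    \<comment> \<open>At each point of the orbit |w| or |w'| is at least |U n|/2. Membership in
      \<open>ell q\<close> is known for V but not yet for w, so the bound on w is restated for
      V.\<close>
    have "Orb n \<subseteq> {m. \<bar>U n\<bar> / 2 \<le> \<bar>w' m\<bar>} \<union> {m. (\<bar>U n\<bar> / 2) powr (q / p) \<le> \<bar>V m\<bar>}"
    proof
      fix m assume m: "m \<in> Orb n"
      have "v m = V m"
        using Orb_eq[OF m] inf by (simp add: v_def C_def)
      then have V_m: "\<bar>V m\<bar> = \<bar>w m\<bar> powr (q / p)"
        using assms q by (simp add: abs_w powr_powr)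
      have "w m - w' m = U n"
        using U_Orb[OF m] by (simp add: U_def)
      then consider "\<bar>U n\<bar> / 2 \<le> \<bar>w' m\<bar>" | "\<bar>U n\<bar> / 2 \<le> \<bar>w m\<bar>"
        by linarith
      then show "m \<in> {m. \<bar>U n\<bar> / 2 \<le> \<bar>w' m\<bar>} \<union> {m. (\<bar>U n\<bar> / 2) powr (q / p) \<le> \<bar>V m\<bar>}"
      proof cases
        case 2
        then have "(\<bar>U n\<bar> / 2) powr (q / p) \<le> \<bar>V m\<bar>"
          unfolding V_m using assms q by (intro powr_mono2) auto
        then show ?thesis by simp
      qed simp
    qed
    moreover have "finite {m. \<bar>U n\<bar> / 2 \<le> \<bar>w' m\<bar>}"
      using w'(1) q pos by (rule ell_finite_large)
    moreover have "finite {m. (\<bar>U n\<bar> / 2) powr (q / p) \<le> \<bar>V m\<bar>}"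
      using V(1) q pos by (intro ell_finite_large) auto
    ultimately show False
      using inf finite_subset by blast
  qed

  have U_finite: "(\<Sum>a\<in>Orb n. \<bar>U a\<bar> powr q) \<le> 2 * (\<Sum>a\<in>Orb n. \<bar>w' a\<bar> powr q)"
    if fin: "finite (Orb n)" for n
  proof -
    \<comment> \<open>The map \<open>sgn_powr\<close> respects signs, so the median 0 of v passes to
      w.\<close>
    have "card {a \<in> Orb n. V a \<le> C n} \<le> card {a \<in> Orb n. w a \<le> 0}"
      using fin C_Orb by (intro card_mono) (auto simp: w_def v_def intro!: sgn_powr_nonpos)
    moreover have "card {a \<in> Orb n. C n \<le> V a} \<le> card {a \<in> Orb n. 0 \<le> w a}"
      using fin C_Orb by (intro card_mono) (auto simp: w_def v_def intro!: sgn_powr_nonneg)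
    ultimately have "real (card (Orb n)) * \<bar>U n\<bar> powr q \<le> 2 * (\<Sum>a\<in>Orb n. \<bar>w' a\<bar> powr q)"
      using fin C_median[OF fin] U_Orb q
      by (intro median_shift_bound[where w = w]) (auto simp: U_def)
    moreover have "(\<Sum>a\<in>Orb n. \<bar>U a\<bar> powr q) = (\<Sum>a\<in>Orb n. \<bar>U n\<bar> powr q)"
      using U_Orb by (intro sum.cong) auto
    ultimately show ?thesis by simp
  qed

  have "U \<in> ell q"
    unfolding ell_def mem_Collect_eq
  proof (rule summableI_nonneg_bounded)
    fix N
    define F where "F = {i. i < N \<and> U i \<noteq> 0}"
    have fin: "finite (Orb i)" if "i \<in> F" for i
      using that U_infinite by (auto simp: F_def)
    have fin_F: "finite F" by (simp add: F_def)
    have disjoint: "\<forall>A\<in>Orb ` F. \<forall>B\<in>Orb ` F. A \<noteq> B \<longrightarrow> A \<inter> B = {}"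
      using Orb_eq by blast
    have fin_K: "finite (\<Union>(Orb ` F))" "\<forall>A\<in>Orb ` F. finite A"
      using fin fin_F by auto
    have Union: "sum f (\<Union>(Orb ` F)) = (\<Sum>A\<in>Orb ` F. sum f A)" for f :: "nat \<Rightarrow> real"
      by (simp add: sum.Union_disjoint[OF fin_K(2) disjoint])
    have "(\<Sum>i<N. \<bar>U i\<bar> powr q) = (\<Sum>i\<in>F. \<bar>U i\<bar> powr q)"
      by (rule sum.mono_neutral_right) (auto simp: F_def)
    also have "\<dots> \<le> (\<Sum>i\<in>\<Union>(Orb ` F). \<bar>U i\<bar> powr q)"
      using fin_K Orb_refl by (intro sum_mono2) auto
    also have "\<dots> = (\<Sum>A\<in>Orb ` F. \<Sum>i\<in>A. \<bar>U i\<bar> powr q)"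
      by (simp add: Union)
    also have "\<dots> \<le> (\<Sum>A\<in>Orb ` F. 2 * (\<Sum>i\<in>A. \<bar>w' i\<bar> powr q))"
      using U_finite fin by (intro sum_mono) auto
    also have "\<dots> = 2 * (\<Sum>A\<in>Orb ` F. \<Sum>i\<in>A. \<bar>w' i\<bar> powr q)"
      by (rule sum_distrib_left[symmetric])
    also have "\<dots> = 2 * (\<Sum>i\<in>\<Union>(Orb ` F). \<bar>w' i\<bar> powr q)"
      by (simp add: Union)
    also have "\<dots> \<le> 2 * (\<Sum>i. \<bar>w' i\<bar> powr q)"
      using fin_K ell_D[OF w'(1)] by (intro mult_left_mono sum_le_suminf) auto
    finally show "(\<Sum>i<N. \<bar>U i\<bar> powr q) \<le> 2 * (\<Sum>i. \<bar>w' i\<bar> powr q)" .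
  qed simp
  then have "(\<lambda>n. U n + w' n) \<in> ell q"
    using w'(1) q by (intro ell_add) auto
  then have "w \<in> ell q"
    by (simp add: U_def)
  then have "v \<in> ell p"
    by (rule ell_dominated[where C = 1]) (use q in \<open>simp add: abs_w powr_powr\<close>)
  with c_v show ?thesis by blast
qed


section \<open>Removing the signs\<close>

text \<open>The points \<open>2 * n\<close> and \<open>2 * n + 1\<close> stand for \<open>(n, 1)\<close> and \<open>(n, -1)\<close>.\<close>
definition signed_index :: "nat \<Rightarrow> bool \<Rightarrow> nat" where
  "signed_index n b = 2 * n + of_bool b"

lemma signed_index_div [simp]: "signed_index n b div 2 = n"
  by (simp add: signed_index_def)

lemma signed_index_odd [simp]: "odd (signed_index n b) \<longleftrightarrow> b"
  by (simp add: signed_index_def)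

lemma signed_index_eta: "signed_index (m div 2) (odd m) = m"
  by (simp add: signed_index_def of_bool_odd_eq_mod_2)

lemma inj_signed_index: "inj (\<lambda>n. signed_index n b)"
  by (rule injI) (simp add: signed_index_def)

lemma ell_double:
  assumes "x \<in> ell s"
  shows "(\<lambda>m. x (m div 2)) \<in> ell s"
  unfolding ell_def mem_Collect_eq
proof (rule summableI_nonneg_bounded)
  fix N
  let ?f = "\<lambda>n. \<bar>x n\<bar> powr s"
  have "(\<Sum>m<2 * K. ?f (m div 2)) = 2 * (\<Sum>n<K. ?f n)" for K
    by (induction K) auto
  then have "(\<Sum>m<N. ?f (m div 2)) \<le> 2 * (\<Sum>n<N. ?f n)"
    using sum_mono2[of "{..<2 * N}" "{..<N}" "\<lambda>m. ?f (m div 2)"] by simp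
  also have "\<dots> \<le> 2 * (\<Sum>n. ?f n)"
    using ell_D[OF assms] by (intro mult_left_mono sum_le_suminf) auto
  finally show "(\<Sum>m<N. ?f (m div 2)) \<le> 2 * (\<Sum>n. ?f n)" .
qed simp

theorem theorem1:
  fixes G :: "('a, 'b) monoid_scheme" and p q :: real
  assumes "group G"
    and "countable (carrier G)"
    and "1 < p" and "p < q" and "p \<noteq> 2"
    and "property_F_ell G q"
  shows "property_F_ell G p"
  unfolding property_F_ell_def
proof (intro allI impI)
  interpret group G by fact
  have p: "0 < p" "0 \<le> p" using assms(3) by simp_all
  fix \<alpha> assume "affine_isometric_action G p \<alpha>"
  then obtain \<pi> b where \<pi>: "isometric_rep G p \<pi>" and b: "cocycle G p \<pi> b"
    and \<alpha>: "\<And>g v. g \<in> carrier G \<Longrightarrow> v \<in> ell p \<Longrightarrow> \<alpha> g v = (\<lambda>n. \<pi> g v n + b g n)"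
    unfolding affine_isometric_action_def by blast
  have hom: "\<pi> \<in> hom G (ell_O p)"
    using \<pi> by (simp add: isometric_rep_def)
  have \<pi>_O: "\<pi> g \<in> Bij (ell p)" "ell_linear p (\<pi> g)" "ell_isometry p (\<pi> g)"
    if "g \<in> carrier G" for g
    using hom_in_carrier[OF hom that] by (simp_all add: ell_O_def)
  have \<pi>_bij: "bij_betw (\<pi> g) (ell p) (ell p)" if "g \<in> carrier G" for g
    using \<pi>_O(1)[OF that] by (simp add: Bij_def)
  have \<pi>_mult: "\<pi> (g \<otimes>\<^bsub>G\<^esub> h) x = \<pi> g (\<pi> h x)"
    if "g \<in> carrier G" "h \<in> carrier G" "x \<in> ell p" for g h x
    using hom_mult[OF hom that(1,2)] \<pi>_O(1) that
    by (simp add: ell_O_def BijGroup_def compose_def)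
  have \<pi>_one: "\<pi> \<one>\<^bsub>G\<^esub> x = x" if x: "x \<in> ell p" for x
  proof -
    have "\<pi> \<one>\<^bsub>G\<^esub> x \<in> ell p"
      using bij_betwE[OF \<pi>_bij] x by blast
    \<comment> \<open>An injective idempotent map is the identity.\<close>
    moreover have "\<pi> \<one>\<^bsub>G\<^esub> (\<pi> \<one>\<^bsub>G\<^esub> x) = \<pi> \<one>\<^bsub>G\<^esub> x"
      using \<pi>_mult[of "\<one>\<^bsub>G\<^esub>" "\<one>\<^bsub>G\<^esub>" x] x by simp
    ultimately show ?thesis
      using bij_betw_imp_inj_on[OF \<pi>_bij[OF one_closed]] x by (meson inj_onD)
  qed
  have "\<exists>\<sigma> \<beta>. signed_perm p (\<pi> g) \<sigma> \<beta>" if "g \<in> carrier G" for g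
    using banach_lamperti p(1) assms(5) \<pi>_O[OF that] \<pi>_bij[OF that] by blast
  then obtain \<sigma> \<beta> where perm: "\<And>g. g \<in> carrier G \<Longrightarrow> signed_perm p (\<pi> g) (\<sigma> g) (\<beta> g)"
    by metis
  have \<pi>_perm: "\<pi> g x (\<sigma> g n) = bool_sign (\<beta> g n) * x n"
    if "g \<in> carrier G" "x \<in> ell p" for g x n
    using perm[OF that(1)] that(2) by (simp add: signed_perm_def)
  have mult: "\<sigma> (g \<otimes>\<^bsub>G\<^esub> h) n = \<sigma> g (\<sigma> h n)"
    "\<beta> (g \<otimes>\<^bsub>G\<^esub> h) n \<longleftrightarrow> (\<beta> g (\<sigma> h n) \<noteq> \<beta> h n)"
    if "g \<in> carrier G" "h \<in> carrier G" for g h n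
    using signed_perm_compose[OF perm[OF m_closed[OF that]] perm[OF that(1)] perm[OF that(2)]
        \<pi>_O(2)[OF that(1)] \<pi>_mult[OF that]] by blast+
  have one: "\<sigma> \<one>\<^bsub>G\<^esub> n = n" "\<not> \<beta> \<one>\<^bsub>G\<^esub> n" for n
  proof -
    have "(\<lambda>m. bool_sign (\<beta> \<one>\<^bsub>G\<^esub> n) * unit_seq (\<sigma> \<one>\<^bsub>G\<^esub> n) m) = \<pi> \<one>\<^bsub>G\<^esub> (unit_seq n)"
      using perm[OF one_closed] by (simp add: signed_perm_def)
    also have "\<dots> = (\<lambda>m. bool_sign False * unit_seq n m)"
      by (simp add: \<pi>_one[OF unit_seq_in_ell] bool_sign_def)
    finally show "\<sigma> \<one>\<^bsub>G\<^esub> n = n" "\<not> \<beta> \<one>\<^bsub>G\<^esub> n"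
      using bool_sign_unit_seq_inject by blast+
  qed

  \<comment> \<open>On pairs (n, sign), g moves n by \<open>\<sigma> g\<close> and multiplies the
    sign by that of \<open>\<beta> g n\<close>.\<close>
  define \<rho> where "\<rho> g m = signed_index (\<sigma> g (m div 2)) (\<beta> g (m div 2) \<noteq> odd m)" for g m
  have action: "group_action G UNIV \<rho>"
  proof (rule group_action_UNIV)
    show "\<rho> \<one>\<^bsub>G\<^esub> m = m" for m
      by (simp add: \<rho>_def one signed_index_eta)
    show "\<rho> (g \<otimes>\<^bsub>G\<^esub> h) m = \<rho> g (\<rho> h m)" if "g \<in> carrier G" "h \<in> carrier G" for g h m
      unfolding \<rho>_def by (simp add: mult[OF that]) (rule arg_cong, blast)
  qed
  have \<rho>_inv: "\<rho> (inv\<^bsub>G\<^esub> g) (\<rho> g m) = m" "\<rho> g (\<rho> (inv\<^bsub>G\<^esub> g) m) = m" if "g \<in> carrier G" for g m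
  proof -
    interpret group_action G UNIV \<rho> by (fact action)
    show "\<rho> (inv\<^bsub>G\<^esub> g) (\<rho> g m) = m"
      using orbit_sym_aux[OF that] by simp
    show "\<rho> g (\<rho> (inv\<^bsub>G\<^esub> g) m) = m"
      using orbit_sym_aux[of "inv\<^bsub>G\<^esub> g" m] that by simp
  qed

  \<comment> \<open>The lift of b that changes sign when \<open>2 * n\<close> and
    \<open>2 * n + 1\<close> are exchanged; on such sequences permuting by \<open>\<rho>\<close>
    reproduces \<open>\<pi>\<close>.\<close>
  define c where "c g m = bool_sign (odd m) * b g (m div 2)" for g m
  have b_ell: "b g \<in> ell p" if "g \<in> carrier G" for g
    using b that by (auto simp: cocycle_def)
  have b_mult: "b (g \<otimes>\<^bsub>G\<^esub> h) n = \<pi> g (b h) n + b g n" if "g \<in> carrier G" "h \<in> carrier G" for g h n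
    using b that by (simp add: cocycle_def)
  have c_ell: "c g \<in> ell p" if "g \<in> carrier G" for g
    by (rule ell_dominated[OF ell_double[OF b_ell[OF that]], of _ _ 1])
      (simp add: c_def bool_sign_def abs_mult)
  have c_mult: "c (g \<otimes>\<^bsub>G\<^esub> h) m = c h (\<rho> (inv\<^bsub>G\<^esub> g) m) + c g m"
    if g: "g \<in> carrier G" and h: "h \<in> carrier G" for g h m
  proof -
    \<comment> \<open>\<open>\<pi>_perm\<close> gives coordinates at indices
      \<open>\<sigma> g n\<close> only, so m is rewritten as the image of k; the two signs from
      \<open>\<beta>\<close> then cancel.\<close>
    define k where "k = \<rho> (inv\<^bsub>G\<^esub> g) m"
    have m: "m = signed_index (\<sigma> g (k div 2)) (\<beta> g (k div 2) \<noteq> odd k)"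
      using \<rho>_inv(2)[OF g, of m] by (simp add: k_def \<rho>_def)
    have "c (g \<otimes>\<^bsub>G\<^esub> h) m - c g m = bool_sign (odd m) * \<pi> g (b h) (m div 2)"
      by (simp add: c_def b_mult[OF g h] algebra_simps)
    also have "\<dots> = bool_sign (\<beta> g (k div 2) \<noteq> odd k) * (bool_sign (\<beta> g (k div 2)) * b h (k div 2))"
      unfolding m signed_index_div signed_index_odd \<pi>_perm[OF g b_ell[OF h]] ..
    also have "\<dots> = c h k"
      by (simp add: c_def bool_sign_def)
    finally show ?thesis
      by (simp add: k_def)
  qed
  obtain v where v: "v \<in> ell p" "\<And>g m. g \<in> carrier G \<Longrightarrow> c g m = v m - v (\<rho> (inv\<^bsub>G\<^esub> g) m)"
    using permutation_cocycle_coboundary_lower[OF assms(1) action p(1) assms(4,6), of c] c_ell c_mult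
    by blast
  \<comment> \<open>The primitive v need not be antisymmetric; u is its antisymmetric part, read at
    the points of sign 1.\<close>
  define u where "u n = (1 / 2) * (v (signed_index n False) - v (signed_index n True))" for n
  have u: "u \<in> ell p"
    unfolding u_def
    by (intro ell_cmult ell_diff[OF p(2)] ell_reindex[OF v(1)] inj_signed_index)
  have "\<alpha> g u = u" if g: "g \<in> carrier G" for g
  proof
    fix m
    define n where "n = \<rho> (inv\<^bsub>G\<^esub> g) (signed_index m False) div 2"
    have m: "m = \<sigma> g n"
    proof -
      have "m = signed_index m False div 2"
        by simp
      also have "\<dots> = \<rho> g (\<rho> (inv\<^bsub>G\<^esub> g) (signed_index m False)) div 2"
        by (simp add: \<rho>_inv(2)[OF g])
      finally show ?thesis
        by (simp add: \<rho>_def n_def)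
    qed
    have c_act: "c g (signed_index m t) = v (signed_index m t) - v (signed_index n (\<beta> g n \<noteq> t))" for t
    proof -
      have "signed_index m t = \<rho> g (signed_index n (\<beta> g n \<noteq> t))"
        by (cases "\<beta> g n") (simp_all add: \<rho>_def m)
      then show ?thesis
        using v(2)[OF g] \<rho>_inv(1)[OF g] by metis
    qed
    have "b g m = (1 / 2) * (c g (signed_index m False) - c g (signed_index m True))"
      by (simp add: c_def bool_sign_def)
    \<comment> \<open>If \<open>\<beta> g n\<close> holds, the two points over n are exchanged,
      which reverses their difference.\<close>
    also have "\<dots> = u m - bool_sign (\<beta> g n) * u n"
      unfolding c_act by (simp add: u_def bool_sign_def algebra_simps)
    finally show "\<alpha> g u m = u m"
      using \<pi>_perm[OF g u, of n] by (simp add: \<alpha>[OF g u] m)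
  qed
  with u show "\<exists>v\<in>ell p. \<forall>g\<in>carrier G. \<alpha> g v = v"
    by blast
qed

end
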